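(* Let $m\in\mathbb{N}$, and for $i\in\{1,2,\ldots,m\}$ let $S_i\subseteq (0,\infty)$ be a dense subsemigroup of $([0,\infty),+)$. Let $S=\prod_{i=1}^m S_i$ and let $A\subseteq S$. The following statements are equivalent. \begin{enumerate} \item For each $i\in \{1,2,\ldots,m\}$, there is an idempotent $p_i\in 0_{S_i}^*$ such that $A\in\otimes_{i=1}^m p_i$. \item For each $i\in\{1,2,\ldots,m\}$, there is a sequence $\langle x_{i,n}\rangle_{n=1}^\infty$ in $S_i$ such that $\sum_{n=1}^\infty x_{i,n}$ converges and $\big\{\big(\sum_{n\in F_1}x_{1,n},\sum_{n\in F_2}x_{2,n},\ldots,\sum_{n\in F_m}x_{m,n}\big): \text{each } F_i\in\mathcal{P}_f(\mathbb{N}) \text{ and } F_1<F_2<\cdots <F_m\big\}\subseteq A$. \end{enumerate}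
   Context: $\beta S$ denotes the set of ultrafilters on $S$ (Stone-Čech compactification of discrete $S$) with the extended operation. For a subsemigroup $S$ of $([0,\infty),+)$, $0_S^*=\{p\in\beta S:(0,\epsilon)\cap S\in p \text{ for all } \epsilon>0\}$. $\mathcal{P}_f(\mathbb{N})$ is the set of finite nonempty subsets of $\mathbb{N}$, and $F<G$ means $\max F<\min G$. The tensor product $\otimes_{i=1}^m p_i\in\beta(\prod_{i=1}^m S_i)$ is defined inductively: $\otimes_{i=1}^1p_i=p_1$, and $A\subseteq\prod_{i=1}^{l+1}S_i$ belongs to $\otimes_{i=1}^{l+1}p_i$ iff $\{(x_1,\ldots,x_l):\{x_{l+1}\in S_{l+1}:(x_1,\ldots,x_{l+1})\in A\}\in p_{l+1}\}\in\otimes_{i=1}^l p_i$. *)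

theory Defs
  imports "HOL-Analysis.Analysis"
begin

text \<open>
  Ultrafilters on a set \<open>X\<close>, i.e. the points of the Stone-Cech compactification of
  the discrete space \<open>X\<close>. They are modelled as sets of subsets of \<open>X\<close>, because the
  semigroups below are subsets of the reals and not types of their own.
\<close>

definition beta :: "'a set \<Rightarrow> 'a set set set" where
  "beta X = {p. p \<subseteq> Pow X \<and> X \<in> p \<and> {} \<notin> p
      \<and> (\<forall>A\<in>p. \<forall>B\<in>p. A \<inter> B \<in> p)
      \<and> (\<forall>A\<in>p. \<forall>B. A \<subseteq> B \<and> B \<subseteq> X \<longrightarrow> B \<in> p)
      \<and> (\<forall>A. A \<subseteq> X \<longrightarrow> A \<in> p \<or> X - A \<in> p)}"

text \<open>
  The extension of addition to \<open>beta S\<close>: \<open>A \<in> p + q\<close> iff \<open>{x. -x + A \<in> q} \<in> p\<close>, where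
  \<open>-x + A = {y \<in> S. x + y \<in> A}\<close>. The opposite convention has the same idempotents, since
  the addition of \<open>S\<close> is commutative.
\<close>

definition beta_plus :: "real set \<Rightarrow> real set set \<Rightarrow> real set set \<Rightarrow> real set set" where
  "beta_plus S p q = {A. A \<subseteq> S \<and> {x \<in> S. {y \<in> S. x + y \<in> A} \<in> q} \<in> p}"

definition zero_star :: "real set \<Rightarrow> real set set set" where
  "zero_star S = {p \<in> beta S. \<forall>\<epsilon>>0. {0<..<\<epsilon>} \<inter> S \<in> p}"

definition dense_subsemigroup :: "real set \<Rightarrow> bool" where
  "dense_subsemigroup S \<longleftrightarrow>
     S \<subseteq> {0..} \<and> S \<noteq> {} \<and> (\<forall>x\<in>S. \<forall>y\<in>S. x + y \<in> S) \<and> {0..} \<subseteq> closure S"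

text \<open>
  \<open>tensor S p l\<close> is the tensor product of \<open>p 1, \<dots>, p l\<close>, an ultrafilter on the product
  of \<open>S 1, \<dots>, S l\<close>; tuples are extensional functions on \<open>{1..l}\<close>. In the case \<open>l = 1\<close>,
  \<open>S 1\<close> is identified with the set of 1-tuples over it. The value at \<open>l = 0\<close> is a dummy.
\<close>

fun tensor :: "(nat \<Rightarrow> 'a set) \<Rightarrow> (nat \<Rightarrow> 'a set set) \<Rightarrow> nat \<Rightarrow> (nat \<Rightarrow> 'a) set set" where
  "tensor S p 0 = {}"
| "tensor S p (Suc 0) =
     {A. A \<subseteq> (\<Pi>\<^sub>E i\<in>{1..1}. S i) \<and> {x \<in> S 1. (\<lambda>i\<in>{1..1}. x) \<in> A} \<in> p 1}"
| "tensor S p (Suc (Suc k)) = (let l = Suc k in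
     {A. A \<subseteq> (\<Pi>\<^sub>E i\<in>{1..l+1}. S i) \<and>
         {x \<in> (\<Pi>\<^sub>E i\<in>{1..l}. S i). {y \<in> S (l+1). x(l+1 := y) \<in> A} \<in> p (l+1)} \<in> tensor S p l})"

text \<open>Finite nonempty sets of positive integers (indices start at 1), and the relation \<open>F < G\<close> on them.\<close>

definition Pf :: "nat set set" where
  "Pf = {F. finite F \<and> F \<noteq> {} \<and> F \<subseteq> {1..}}"

definition set_less :: "nat set \<Rightarrow> nat set \<Rightarrow> bool" where
  "set_less F G \<longleftrightarrow> Max F < Min G"

end

theory Submission
  imports Defs
begin

text \<open>
  For the implication from sums to ultrafilters, the tails of the set of finite sums of a sequence
  generate a filter whose ultrafilters form a closed subsemigroup of \<open>beta S\<close>, and Ellis' lemma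
  (carried out here with filters in place of closed sets) yields an idempotent. Conversely, if
  \<open>p\<close> is idempotent then every \<open>B \<in> p\<close> contains \<open>B* = {x \<in> B. -x + B \<in> p} \<in> p\<close>, and
  \<open>-x + B* \<in> p\<close> for \<open>x \<in> B*\<close>. Unfolding the tensor product, each admissible tuple of sums in the
  first \<open>k\<close> coordinates determines such a \<open>B\<close> for the coordinate \<open>k + 1\<close>. Hence the
  \<open>n\<close>-th terms of all \<open>m\<close> sequences can be chosen simultaneously, since each only has to lie
  in finitely many large sets determined by the earlier terms.
\<close>

section \<open>Filters and ultrafilters on a set\<close>

definition proper_filter :: "'a set \<Rightarrow> 'a set set \<Rightarrow> bool" where
  "proper_filter S F \<longleftrightarrow> F \<subseteq> Pow S \<and> S \<in> F \<and> {} \<notin> F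
      \<and> (\<forall>A\<in>F. \<forall>B\<in>F. A \<inter> B \<in> F) \<and> (\<forall>A\<in>F. \<forall>B. A \<subseteq> B \<and> B \<subseteq> S \<longrightarrow> B \<in> F)"

lemma beta_iff: "p \<in> beta S \<longleftrightarrow> proper_filter S p \<and> (\<forall>A\<subseteq>S. A \<in> p \<or> S - A \<in> p)"
  by (simp add: beta_def proper_filter_def conj_assoc)

lemma
  assumes "proper_filter S F"
  shows proper_filter_subset: "A \<in> F \<Longrightarrow> A \<subseteq> S"
    and proper_filter_space: "S \<in> F"
    and proper_filter_nonempty: "A \<in> F \<Longrightarrow> A \<noteq> {}"
    and proper_filter_Int: "A \<in> F \<Longrightarrow> B \<in> F \<Longrightarrow> A \<inter> B \<in> F"
    and proper_filter_mono: "A \<in> F \<Longrightarrow> A \<subseteq> B \<Longrightarrow> B \<subseteq> S \<Longrightarrow> B \<in> F"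
  using assms unfolding proper_filter_def by blast+

lemma beta_proper_filter: "p \<in> beta S \<Longrightarrow> proper_filter S p"
  by (simp add: beta_iff)

lemma beta_Diff_iff:
  assumes "p \<in> beta S" "A \<subseteq> S"
  shows "S - A \<in> p \<longleftrightarrow> A \<notin> p"
proof -
  note pf = beta_proper_filter[OF assms(1)]
  have "False" if "S - A \<in> p" "A \<in> p"
    using proper_filter_nonempty[OF pf proper_filter_Int[OF pf that]] by auto
  moreover have "A \<in> p \<or> S - A \<in> p"
    using assms by (simp add: beta_iff)
  ultimately show ?thesis by blast
qed

lemma beta_eqI:
  assumes "p \<in> beta S" "q \<in> beta S" "p \<subseteq> q"
  shows "p = q"
proof (rule ccontr)
  assume "p \<noteq> q"
  then obtain A where A: "A \<in> q" "A \<notin> p"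
    using assms(3) by blast
  then have "A \<subseteq> S"
    using proper_filter_subset[OF beta_proper_filter[OF assms(2)]] by simp
  then have "S - A \<in> p" "S - A \<notin> q"
    using A beta_Diff_iff[OF assms(1) \<open>A \<subseteq> S\<close>] beta_Diff_iff[OF assms(2) \<open>A \<subseteq> S\<close>]
    by simp_all
  then show False
    using assms(3) by blast
qed

lemma proper_filter_Inter:
  assumes "proper_filter S F" "finite I" "\<And>i. i \<in> I \<Longrightarrow> B i \<in> F"
  shows "{x \<in> S. \<forall>i\<in>I. x \<in> B i} \<in> F"
  using assms(2,3)
proof (induction I)
  case empty
  then show ?case using assms(1) by (simp add: proper_filter_space)
next
  case (insert j I)
  then have "B j \<inter> {x \<in> S. \<forall>i\<in>I. x \<in> B i} \<in> F"
    using assms(1) by (intro proper_filter_Int) auto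
  moreover have "{x \<in> S. \<forall>i\<in>insert j I. x \<in> B i} = B j \<inter> {x \<in> S. \<forall>i\<in>I. x \<in> B i}"
    by auto
  ultimately show ?case by simp
qed

text \<open>\<open>H\<close> is the filter generated by \<open>F\<close> and \<open>G\<close>: the
  sets \<open>D \<inter> B\<close> are closed under intersection and, by \<open>meet\<close>,
  nonempty.\<close>

lemma proper_filter_adjoin:
  assumes F: "proper_filter S F" and G: "G \<noteq> {}" "G \<subseteq> Pow S"
    and GInt: "\<And>A B. A \<in> G \<Longrightarrow> B \<in> G \<Longrightarrow> A \<inter> B \<in> G"
    and meet: "\<And>A B. A \<in> F \<Longrightarrow> B \<in> G \<Longrightarrow> A \<inter> B \<noteq> {}"
  defines "H \<equiv> {A. A \<subseteq> S \<and> (\<exists>D\<in>F. \<exists>B\<in>G. D \<inter> B \<subseteq> A)}"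
  shows "proper_filter S H" "F \<subseteq> H" "G \<subseteq> H"
proof -
  show "F \<subseteq> H"
    using proper_filter_subset[OF F] G unfolding H_def by blast
  show "G \<subseteq> H"
    using proper_filter_space[OF F] G unfolding H_def by blast
  have "A \<inter> A' \<in> H" if "A \<in> H" "A' \<in> H" for A A'
  proof -
    from that(1) obtain D B where "D \<in> F" "B \<in> G" "D \<inter> B \<subseteq> A"
      by (auto simp: H_def)
    moreover from that(2) obtain D' B' where "D' \<in> F" "B' \<in> G" "D' \<inter> B' \<subseteq> A'"
      by (auto simp: H_def)
    ultimately have *: "D \<in> F" "B \<in> G" "D \<inter> B \<subseteq> A" "D' \<in> F" "B' \<in> G" "D' \<inter> B' \<subseteq> A'"
      by auto
    have "(D \<inter> D') \<inter> (B \<inter> B') \<subseteq> A \<inter> A'"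
      using * by blast
    moreover have "D \<inter> D' \<in> F" "B \<inter> B' \<in> G"
      using * F GInt by (auto intro: proper_filter_Int)
    ultimately show ?thesis
      using that unfolding H_def by blast
  qed
  moreover have "{} \<notin> H"
    using meet unfolding H_def by blast
  moreover have "S \<in> H"
    using \<open>F \<subseteq> H\<close> proper_filter_space[OF F] by blast
  moreover have "H \<subseteq> Pow S"
    by (auto simp: H_def)
  moreover have "B \<in> H" if "A \<in> H" "A \<subseteq> B \<and> B \<subseteq> S" for A B
    using that unfolding H_def by (blast intro: subset_trans)
  ultimately show "proper_filter S H"
    unfolding proper_filter_def by simp
qed

lemma proper_filter_Union_chain:
  assumes "C \<noteq> {}" "\<And>F. F \<in> C \<Longrightarrow> proper_filter S F"
    and "\<And>F G. F \<in> C \<Longrightarrow> G \<in> C \<Longrightarrow> F \<subseteq> G \<or> G \<subseteq> F"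
  shows "proper_filter S (\<Union>C)"
proof -
  have "A \<inter> B \<in> \<Union>C" if "A \<in> \<Union>C" "B \<in> \<Union>C" for A B
  proof -
    from that obtain F G where "F \<in> C" "A \<in> F" "G \<in> C" "B \<in> G"
      by blast
    with assms(3)[of F G] assms(2) show ?thesis
      by (metis UnionI proper_filter_Int subsetD)
  qed
  moreover have "S \<in> \<Union>C" "{} \<notin> \<Union>C" "\<Union>C \<subseteq> Pow S"
    using assms(1) assms(2)[unfolded proper_filter_def] by blast+
  moreover have "B \<in> \<Union>C" if "A \<in> \<Union>C" "A \<subseteq> B \<and> B \<subseteq> S" for A B
    using that assms(2) by (meson UnionE UnionI proper_filter_mono)
  ultimately show ?thesis
    unfolding proper_filter_def by simp
qed

text \<open>A maximal proper filter above \<open>F\<close> is an ultrafilter: a set meeting all its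
  members can be adjoined and so belongs to it already; otherwise some member lies in the complement
  of that set.\<close>

lemma ultrafilter_extension:
  assumes "proper_filter S F"
  obtains p where "p \<in> beta S" "F \<subseteq> p"
proof -
  let ?X = "{G. proper_filter S G \<and> F \<subseteq> G}"
  have "\<exists>M\<in>?X. \<forall>G\<in>?X. M \<subseteq> G \<longrightarrow> G = M"
  proof (rule subset_Zorn_nonempty)
    show "?X \<noteq> {}" using assms by blast
    show "\<Union>C \<in> ?X" if "C \<noteq> {}" "subset.chain ?X C" for C
    proof -
      have "proper_filter S (\<Union>C)"
        by (rule proper_filter_Union_chain) (use that in \<open>auto simp: subset_chain_def\<close>)
      moreover have "F \<subseteq> \<Union>C"
        using that by (fastforce simp: subset_chain_def)
      ultimately show ?thesis
        by simp
    qed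
  qed
  then obtain M where "M \<in> ?X" and max': "\<forall>G\<in>?X. M \<subseteq> G \<longrightarrow> G = M"
    by (rule bexE)
  then have M: "proper_filter S M" "F \<subseteq> M"
    by simp_all
  have max: "G = M" if "proper_filter S G" "M \<subseteq> G" for G
    using max' that subset_trans[OF M(2) that(2)] by simp
  have "A \<in> M \<or> S - A \<in> M" if "A \<subseteq> S" for A
  proof (cases "\<forall>D\<in>M. D \<inter> A \<noteq> {}")
    case True
    note H = proper_filter_adjoin[OF M(1), of "{A}"]
    have "{A} \<subseteq> {B. B \<subseteq> S \<and> (\<exists>D\<in>M. \<exists>B'\<in>{A}. D \<inter> B' \<subseteq> B)}"
      by (rule H(3)) (use True that in auto)
    also have "\<dots> = M"
      by (rule max; rule H) (use True that in auto)
    finally show ?thesis by simp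
  next
    case False
    then obtain D where "D \<in> M" "D \<inter> A = {}" by blast
    then have "D \<subseteq> S - A"
      using proper_filter_subset[OF M(1)] by blast
    then have "S - A \<in> M"
      using proper_filter_mono[OF M(1) \<open>D \<in> M\<close>] by blast
    then show ?thesis ..
  qed
  then have "M \<in> beta S"
    using M(1) by (simp add: beta_iff)
  then show thesis
    using that M(2) by blast
qed

section \<open>Existence of idempotents\<close>

definition shift :: "real set \<Rightarrow> real \<Rightarrow> real set \<Rightarrow> real set" where
  "shift S x A = {y \<in> S. x + y \<in> A}"

text \<open>For \<open>A \<subseteq> S\<close>, \<open>A\<close> belongs to p + q iff
  \<open>lead S q A\<close> belongs to p. The map \<open>lead S q\<close> commutes with
  intersections for a proper filter q and also with complements for an ultrafilter q, which turns
  statements about p + q into set algebra.\<close>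

definition lead :: "real set \<Rightarrow> real set set \<Rightarrow> real set \<Rightarrow> real set" where
  "lead S q A = {x \<in> S. shift S x A \<in> q}"

lemma mem_beta_plus: "A \<in> beta_plus S p q \<longleftrightarrow> A \<subseteq> S \<and> lead S q A \<in> p"
  by (simp add: beta_plus_def lead_def shift_def)

lemma lead_subset: "lead S q A \<subseteq> S"
  by (auto simp: lead_def)

lemma shift_subset: "shift S x A \<subseteq> S"
  by (auto simp: shift_def)

lemma lead_mono:
  assumes "proper_filter S q" "A \<subseteq> B"
  shows "lead S q A \<subseteq> lead S q B"
proof
  fix x assume x: "x \<in> lead S q A"
  have "shift S x A \<subseteq> shift S x B"
    using assms(2) by (auto simp: shift_def)
  then show "x \<in> lead S q B"
    using x proper_filter_mono[OF assms(1) _ _ shift_subset] by (auto simp: lead_def)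
qed

lemma lead_Int:
  assumes "proper_filter S q"
  shows "lead S q (A \<inter> B) = lead S q A \<inter> lead S q B"
proof
  show "lead S q (A \<inter> B) \<subseteq> lead S q A \<inter> lead S q B"
    by (simp add: lead_mono[OF assms])
  have "shift S x (A \<inter> B) = shift S x A \<inter> shift S x B" for x
    by (auto simp: shift_def)
  then show "lead S q A \<inter> lead S q B \<subseteq> lead S q (A \<inter> B)"
    using proper_filter_Int[OF assms] by (auto simp: lead_def)
qed

locale real_subsemigroup =
  fixes S :: "real set"
  assumes add_closed: "x \<in> S \<Longrightarrow> y \<in> S \<Longrightarrow> x + y \<in> S"
begin

lemma lead_space:
  assumes "proper_filter S q"
  shows "lead S q S = S"
proof -
  have "shift S x S = S" if "x \<in> S" for x
    using that add_closed by (auto simp: shift_def)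
  then show ?thesis
    using proper_filter_space[OF assms] by (auto simp: lead_def)
qed

lemma lead_empty: "proper_filter S q \<Longrightarrow> lead S q {} = {}"
  by (auto simp: lead_def shift_def proper_filter_def)

lemma lead_Diff:
  assumes "q \<in> beta S"
  shows "lead S q (S - A) = S - lead S q A"
proof -
  have "shift S x (S - A) = S - shift S x A" if "x \<in> S" for x
    using that add_closed by (auto simp: shift_def)
  then show ?thesis
    using beta_Diff_iff[OF assms shift_subset] by (auto simp: lead_def)
qed

text \<open>Associativity of addition on points: -(x + y) + A = -y + (-x + A).\<close>

lemma shift_lead:
  assumes "x \<in> S"
  shows "shift S x (lead S q A) = lead S q (shift S x A)"
proof -
  have "shift S (x + y) A = shift S y (shift S x A)" if "y \<in> S" for y
    using that assms add_closed by (auto simp: shift_def add.assoc)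
  then show ?thesis
    using assms add_closed by (auto simp: lead_def shift_def[of S x "Collect _"])
qed

text \<open>This is associativity of the extended operation: for \<open>A \<subseteq> S\<close>, the
  left side belongs to s iff \<open>A\<close> lies in s + (r + p), the right side iff
  \<open>A\<close> lies in (s + r) + p.\<close>

lemma lead_beta_plus: "lead S (beta_plus S r p) A = lead S r (lead S p A)"
  unfolding lead_def[of S "beta_plus S r p"] lead_def[of S r]
  using shift_lead shift_subset by (auto simp: mem_beta_plus)

text \<open>The filter laws pull back along \<open>lead S q\<close>. The first argument of
  \<open>beta_plus\<close> is a filter here: if \<open>F\<close> describes a closed set C and q is
  an ultrafilter, then \<open>beta_plus S F q\<close> describes the translate C + q.\<close>

lemma proper_filter_beta_plus:
  assumes "proper_filter S F" "proper_filter S q"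
  shows "proper_filter S (beta_plus S F q)"
  unfolding proper_filter_def
proof (intro conjI ballI allI impI)
  show "beta_plus S F q \<subseteq> Pow S"
    by (auto simp: mem_beta_plus)
  show "S \<in> beta_plus S F q"
    using lead_space[OF assms(2)] proper_filter_space[OF assms(1)] by (simp add: mem_beta_plus)
  show "{} \<notin> beta_plus S F q"
    using lead_empty[OF assms(2)] proper_filter_nonempty[OF assms(1)] by (auto simp: mem_beta_plus)
  show "A \<inter> B \<in> beta_plus S F q" if "A \<in> beta_plus S F q" "B \<in> beta_plus S F q" for A B
    using that lead_Int[OF assms(2)] proper_filter_Int[OF assms(1)] by (auto simp: mem_beta_plus)
  show "B \<in> beta_plus S F q" if "A \<in> beta_plus S F q" "A \<subseteq> B \<and> B \<subseteq> S" for A B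
    using that lead_mono[OF assms(2), of A B] proper_filter_mono[OF assms(1) _ _ lead_subset]
    by (auto simp: mem_beta_plus)
qed

lemma beta_plus_beta:
  assumes "p \<in> beta S" "q \<in> beta S"
  shows "beta_plus S p q \<in> beta S"
  unfolding beta_iff
proof (intro conjI allI impI)
  show "proper_filter S (beta_plus S p q)"
    using assms by (intro proper_filter_beta_plus beta_proper_filter)
  show "A \<in> beta_plus S p q \<or> S - A \<in> beta_plus S p q" if "A \<subseteq> S" for A
    using that beta_Diff_iff[OF assms(1) lead_subset] by (auto simp: mem_beta_plus lead_Diff[OF assms(2)])
qed

section \<open>Closed subsemigroups and Ellis' lemma in terms of filters\<close>

text \<open>
  A filter \<open>F\<close> corresponds to the closed set of the ultrafilters containing it; \<open>semigroup_filter F\<close>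
  says that this closed set is a subsemigroup of \<open>beta S\<close>.
\<close>

definition semigroup_filter :: "real set set \<Rightarrow> bool" where
  "semigroup_filter F \<longleftrightarrow> proper_filter S F \<and> (\<forall>A\<in>F. \<forall>q\<in>beta S. F \<subseteq> q \<longrightarrow> lead S q A \<in> F)"

text \<open>An r with r + p = q has to contain \<open>lead S p C\<close> for every C in q. If such a
  set missed a member of \<open>M\<close>, then \<open>S - C\<close> would lie in
  \<open>beta_plus S M p\<close>, hence in q. So these sets and \<open>M\<close> generate a proper
  filter, and r is any ultrafilter above it.\<close>

lemma beta_plus_factor:
  assumes M: "proper_filter S M" and p: "p \<in> beta S"
    and q: "q \<in> beta S" "beta_plus S M p \<subseteq> q"
  obtains r where "r \<in> beta S" "M \<subseteq> r" "beta_plus S r p = q"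
proof -
  let ?G = "lead S p ` q"
  note pf = beta_proper_filter[OF p] and qf = beta_proper_filter[OF q(1)]
  have meet: "A \<inter> B \<noteq> {}" if "A \<in> M" "B \<in> ?G" for A B
  proof
    assume disj: "A \<inter> B = {}"
    from that obtain C where C: "C \<in> q" "B = lead S p C"
      by blast
    have "A \<subseteq> lead S p (S - C)"
      using disj that proper_filter_subset[OF M] by (auto simp: lead_Diff[OF p] C)
    then have "lead S p (S - C) \<in> M"
      using proper_filter_mono[OF M that(1) _ lead_subset] by simp
    then have "S - C \<in> q"
      using q(2) by (auto simp: mem_beta_plus)
    then show False
      using C(1) beta_Diff_iff[OF q(1) proper_filter_subset[OF qf C(1)]] by simp
  qed
  have GInt: "A \<inter> B \<in> ?G" if "A \<in> ?G" "B \<in> ?G" for A B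
    using that proper_filter_Int[OF qf] by (force simp flip: lead_Int[OF pf])
  have G: "?G \<noteq> {}" "?G \<subseteq> Pow S"
    using proper_filter_space[OF qf] lead_subset by auto
  note H = proper_filter_adjoin[OF M G GInt meet]
  obtain r where "r \<in> beta S" and sub: "{A. A \<subseteq> S \<and> (\<exists>D\<in>M. \<exists>B\<in>?G. D \<inter> B \<subseteq> A)} \<subseteq> r"
    using ultrafilter_extension[OF H(1)] .
  then have r: "r \<in> beta S" "M \<subseteq> r" "?G \<subseteq> r"
    using subset_trans[OF H(2) sub] subset_trans[OF H(3) sub] by simp_all
  have "q \<subseteq> beta_plus S r p"
    using r(3) proper_filter_subset[OF qf] by (auto simp: mem_beta_plus)
  then have "beta_plus S r p = q"
    using beta_eqI[OF q(1) beta_plus_beta[OF r(1) p]] by simp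
  then show thesis
    using that r by blast
qed

text \<open>An ultrafilter above the translate has the form r + p with r above \<open>M\<close>, and
  \<open>lead S r (lead S p A)\<close> is in \<open>M\<close> because \<open>lead S p A\<close> is.
  This is the passage from a closed subsemigroup C to C + p for p in C.\<close>

lemma semigroup_filter_translate:
  assumes M: "semigroup_filter M" and p: "p \<in> beta S" "M \<subseteq> p"
  shows "semigroup_filter (beta_plus S M p)" "M \<subseteq> beta_plus S M p"
proof -
  have Mf: "proper_filter S M"
    using M by (simp add: semigroup_filter_def)
  show sub: "M \<subseteq> beta_plus S M p"
    using M p proper_filter_subset[OF Mf] by (auto simp: semigroup_filter_def mem_beta_plus)
  have "lead S q A \<in> beta_plus S M p"
    if A: "A \<in> beta_plus S M p" and q: "q \<in> beta S" "beta_plus S M p \<subseteq> q" for A q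
  proof -
    obtain r where r: "r \<in> beta S" "M \<subseteq> r" "beta_plus S r p = q"
      using beta_plus_factor[OF Mf p(1) q] .
    have "lead S r (lead S p A) \<in> M"
      using A M r by (auto simp: mem_beta_plus semigroup_filter_def)
    then show ?thesis
      using sub r(3) by (auto simp flip: lead_beta_plus)
  qed
  then show "semigroup_filter (beta_plus S M p)"
    using proper_filter_beta_plus[OF Mf beta_proper_filter[OF p(1)]]
    by (simp add: semigroup_filter_def)
qed

text \<open>
  The filter \<open>N\<close> corresponds to the closed set of those \<open>r\<close> above \<open>M\<close> with \<open>r + p = p\<close>.
\<close>

lemma semigroup_filter_stabilizer:
  assumes M: "semigroup_filter M" "beta_plus S M p = M" and p: "p \<in> beta S" "M \<subseteq> p"
  obtains N where "semigroup_filter N" "M \<subseteq> N" "lead S p ` p \<subseteq> N"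
proof -
  have Mf: "proper_filter S M"
    using M by (simp add: semigroup_filter_def)
  note pf = beta_proper_filter[OF p(1)]
  let ?G = "lead S p ` p"
  let ?N = "{A. A \<subseteq> S \<and> (\<exists>D\<in>M. \<exists>B\<in>?G. D \<inter> B \<subseteq> A)}"
  have meet: "A \<inter> B \<noteq> {}" if "A \<in> M" "B \<in> ?G" for A B
  proof
    assume disj: "A \<inter> B = {}"
    from that obtain C where C: "C \<in> p" "B = lead S p C"
      by blast
    have "A \<subseteq> lead S p (S - C)"
      using disj that proper_filter_subset[OF Mf] by (auto simp: lead_Diff[OF p(1)] C)
    then have "lead S p (S - C) \<in> M"
      using proper_filter_mono[OF Mf that(1) _ lead_subset] by simp
    then have "S - C \<in> beta_plus S M p"
      by (auto simp: mem_beta_plus)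
    \<comment> \<open>Here the equation \<open>beta_plus S M p = M\<close> is used, together with
      \<open>M \<subseteq> p\<close>.\<close>
    then have "S - C \<in> p"
      using M p by blast
    then show False
      using C(1) beta_Diff_iff[OF p(1) proper_filter_subset[OF pf C(1)]] by simp
  qed
  have GInt: "A \<inter> B \<in> ?G" if "A \<in> ?G" "B \<in> ?G" for A B
    using that proper_filter_Int[OF pf] by (force simp flip: lead_Int[OF pf])
  have G: "?G \<noteq> {}" "?G \<subseteq> Pow S"
    using proper_filter_space[OF pf] lead_subset by auto
  note N = proper_filter_adjoin[OF Mf G GInt meet]
  have "lead S q A \<in> ?N" if A: "A \<in> ?N" and q: "q \<in> beta S" "?N \<subseteq> q" for A q
  proof -
    have qf: "proper_filter S q"
      using q(1) by (rule beta_proper_filter)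
    obtain D C where DC: "D \<in> M" "C \<in> p" "D \<inter> lead S p C \<subseteq> A"
      using A by blast
    have "?G \<subseteq> q" "M \<subseteq> q"
      using subset_trans[OF N(3) q(2)] subset_trans[OF N(2) q(2)] by simp_all
    \<comment> \<open>That q contains \<open>?G\<close> says exactly that p is contained in q + p;
      by maximality q + p = p.\<close>
    have "p \<subseteq> beta_plus S q p"
      using \<open>?G \<subseteq> q\<close> proper_filter_subset[OF pf] by (auto simp: mem_beta_plus)
    then have "beta_plus S q p = p"
      using beta_eqI[OF p(1) beta_plus_beta[OF q(1) p(1)]] by simp
    \<comment> \<open>By associativity \<open>lead S q\<close> fixes the generators
      \<open>lead S p C\<close>, while it maps \<open>M\<close> into itself; so it preserves the
      generated filter.\<close>
    then have "lead S q (lead S p C) = lead S p C"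
      by (simp flip: lead_beta_plus)
    then have "lead S q D \<inter> lead S p C \<subseteq> lead S q A"
      using lead_mono[OF qf DC(3)] by (simp add: lead_Int[OF qf])
    moreover have "lead S q D \<in> M"
      using M(1) DC(1) q(1) \<open>M \<subseteq> q\<close> by (simp add: semigroup_filter_def)
    ultimately show ?thesis
      using DC(2) lead_subset by blast
  qed
  then have "semigroup_filter ?N"
    unfolding semigroup_filter_def by (intro conjI ballI impI N(1))
  then show thesis
    using N(2,3) by (rule that)
qed

text \<open>Zorn's lemma gives a maximal semigroup filter \<open>M\<close>, that is, a minimal
  closed subsemigroup C. For p in C, minimality yields first C + p = C and then that the stabilizer
  of p in C is all of C; it contains p, so p + p = p.\<close>

theorem idempotent_exists:
  assumes "semigroup_filter F"
  obtains p where "p \<in> beta S" "F \<subseteq> p" "beta_plus S p p = p"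
proof -
  let ?X = "{G. semigroup_filter G \<and> F \<subseteq> G}"
  have "\<exists>M\<in>?X. \<forall>G\<in>?X. M \<subseteq> G \<longrightarrow> G = M"
  proof (rule subset_Zorn_nonempty)
    show "?X \<noteq> {}" using assms by blast
    show "\<Union>C \<in> ?X" if C: "C \<noteq> {}" "subset.chain ?X C" for C
    proof -
      have "proper_filter S (\<Union>C)"
        by (rule proper_filter_Union_chain)
          (use C in \<open>auto simp: subset_chain_def semigroup_filter_def\<close>)
      moreover have "lead S q A \<in> \<Union>C" if "A \<in> \<Union>C" "q \<in> beta S" "\<Union>C \<subseteq> q" for A q
      proof -
        from that(1) obtain G where G: "G \<in> C" "A \<in> G"
          by blast
        moreover have "G \<subseteq> q" "semigroup_filter G"
          using G that(3) C(2) by (auto simp: subset_chain_def)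
        ultimately show ?thesis
          using that(2) by (auto simp: semigroup_filter_def)
      qed
      ultimately have "semigroup_filter (\<Union>C)"
        by (simp add: semigroup_filter_def)
      moreover have "F \<subseteq> \<Union>C"
        using C by (fastforce simp: subset_chain_def)
      ultimately show ?thesis
        by simp
    qed
  qed
  then obtain M where "M \<in> ?X" and max': "\<forall>G\<in>?X. M \<subseteq> G \<longrightarrow> G = M"
    by (rule bexE)
  then have M: "semigroup_filter M" "F \<subseteq> M"
    by simp_all
  have max: "G = M" if "semigroup_filter G" "M \<subseteq> G" for G
    using max' that subset_trans[OF M(2) that(2)] by simp
  have Mf: "proper_filter S M"
    using M by (simp add: semigroup_filter_def)
  obtain p where p: "p \<in> beta S" "M \<subseteq> p"
    using ultrafilter_extension[OF Mf] .
  have "beta_plus S M p = M"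
    using semigroup_filter_translate[OF M(1) p] by (rule max)
  then obtain N where N: "semigroup_filter N" "M \<subseteq> N" "lead S p ` p \<subseteq> N"
    using semigroup_filter_stabilizer[OF M(1) _ p] by blast
  then have "N = M"
    using max by blast
  then have "lead S p ` p \<subseteq> p"
    using subset_trans[OF N(3)] p(2) by simp
  then have "p \<subseteq> beta_plus S p p"
    using proper_filter_subset[OF beta_proper_filter[OF p(1)]] by (auto simp: mem_beta_plus)
  then have "beta_plus S p p = p"
    using beta_eqI[OF p(1) beta_plus_beta[OF p(1) p(1)]] by simp
  then show thesis
    using that p M(2) by blast
qed

text \<open>Idempotence gives \<open>lead S p C \<in> p\<close> for every C in p. Applied to
  \<open>B\<close> this is the first claim; applied to the translate \<open>shift S x B\<close>,
  with \<open>shift_lead\<close>, it is the second.\<close>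

lemma idempotent_star:
  assumes p: "p \<in> beta S" "beta_plus S p p = p" and B: "B \<in> p"
  shows "B \<inter> lead S p B \<in> p"
    and "x \<in> B \<inter> lead S p B \<Longrightarrow> shift S x (B \<inter> lead S p B) \<in> p"
proof -
  note pf = beta_proper_filter[OF p(1)]
  have lead: "lead S p C \<in> p" if "C \<in> p" for C
    using that p(2) mem_beta_plus by blast
  then show "B \<inter> lead S p B \<in> p"
    using B pf by (intro proper_filter_Int)
  assume x: "x \<in> B \<inter> lead S p B"
  then have *: "x \<in> S" "shift S x B \<in> p"
    by (auto simp: lead_def)
  have "shift S x (B \<inter> lead S p B) = shift S x B \<inter> lead S p (shift S x B)"
    unfolding shift_lead[OF *(1), symmetric] by (auto simp: shift_def)
  then show "shift S x (B \<inter> lead S p B) \<in> p"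
    using * lead pf by (simp add: proper_filter_Int)
qed

section \<open>Finite sums\<close>

lemma sum_closed:
  assumes "finite F" "F \<noteq> {}" "\<And>n. n \<in> F \<Longrightarrow> x n \<in> S"
  shows "sum x F \<in> S"
  using assms by (induction F rule: finite_ne_induct) (auto intro: add_closed)

end

definition finite_sums :: "(nat \<Rightarrow> real) \<Rightarrow> nat \<Rightarrow> real set" where
  "finite_sums x k = {sum x F | F. F \<in> Pf \<and> F \<subseteq> {k..}}"

lemma finite_sums_antimono: "k \<le> l \<Longrightarrow> finite_sums x l \<subseteq> finite_sums x k"
  unfolding finite_sums_def by fastforce

lemma (in real_subsemigroup) finite_sums_subset:
  assumes "\<And>n. n \<ge> 1 \<Longrightarrow> x n \<in> S"
  shows "finite_sums x k \<subseteq> S"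
proof
  fix s assume "s \<in> finite_sums x k"
  then obtain F where "F \<in> Pf" "s = sum x F"
    by (auto simp: finite_sums_def)
  then show "s \<in> S"
    using assms by (auto simp: Pf_def intro!: sum_closed)
qed

text \<open>For s = \<open>sum x F\<close>, the sums over index sets beyond \<open>Max F\<close> can
  be added to s without overlap, so -s + A contains a whole tail. It is thus in the filter and in
  every q above it.\<close>

lemma (in real_subsemigroup) finite_sums_semigroup_filter:
  assumes x: "\<And>n. n \<ge> 1 \<Longrightarrow> x n \<in> S"
  shows "semigroup_filter {A. A \<subseteq> S \<and> (\<exists>k. finite_sums x k \<subseteq> A)}" (is "semigroup_filter ?F")
proof -
  note sub = finite_sums_subset[of x, OF x]
  \<comment> \<open>The witness is \<open>{Suc k}\<close> and not \<open>{k}\<close>, since members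
    of \<open>Pf\<close> exclude the index 0.\<close>
  have ne: "finite_sums x k \<noteq> {}" for k
    by (auto simp: finite_sums_def Pf_def intro!: exI[of _ "{Suc k}"])
  have "A \<inter> B \<in> ?F" if "A \<in> ?F" "B \<in> ?F" for A B
  proof -
    from that obtain k l where kl: "finite_sums x k \<subseteq> A" "finite_sums x l \<subseteq> B"
      by blast
    have "finite_sums x (max k l) \<subseteq> A \<inter> B"
      using kl finite_sums_antimono[of k "max k l" x] finite_sums_antimono[of l "max k l" x]
      by auto
    then show ?thesis
      using that by blast
  qed
  moreover have "S \<in> ?F" "{} \<notin> ?F"
    using sub ne by auto
  moreover have "?F \<subseteq> Pow S"
    by auto
  moreover have "B \<in> ?F" if "A \<in> ?F" "A \<subseteq> B \<and> B \<subseteq> S" for A B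
    using that by (auto intro: subset_trans)
  ultimately have "proper_filter S ?F"
    unfolding proper_filter_def by (intro conjI ballI allI impI)
  moreover have "lead S q A \<in> ?F" if A: "A \<in> ?F" and q: "q \<in> beta S" "?F \<subseteq> q" for A q
  proof -
    obtain k where k: "finite_sums x k \<subseteq> A"
      using A by blast
    have "finite_sums x k \<subseteq> lead S q A"
    proof
      fix s assume s: "s \<in> finite_sums x k"
      then obtain F where F: "F \<in> Pf" "F \<subseteq> {k..}" "s = sum x F"
        by (auto simp: finite_sums_def)
      have "finite_sums x (Suc (Max F)) \<subseteq> shift S s A"
      proof
        fix t assume t: "t \<in> finite_sums x (Suc (Max F))"
        then obtain G where G: "G \<in> Pf" "G \<subseteq> {Suc (Max F)..}" "t = sum x G"
          by (auto simp: finite_sums_def)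
        have "n \<notin> G" if "n \<in> F" for n
          using Max_ge[OF _ that] F(1) G(2) by (auto simp: Pf_def)
        then have disj: "F \<inter> G = {}"
          by blast
        have "Max F \<in> F"
          using F(1) by (simp add: Pf_def)
        then have "k \<le> Max F"
          using F(2) by auto
        then have "F \<union> G \<in> Pf" "F \<union> G \<subseteq> {k..}"
          using F G by (auto simp: Pf_def)
        moreover have "s + t = sum x (F \<union> G)"
          using F G disj by (simp add: Pf_def sum.union_disjoint)
        ultimately have "s + t \<in> A"
          using k by (auto simp: finite_sums_def)
        then show "t \<in> shift S s A"
          using t sub by (auto simp: shift_def)
      qed
      then have "shift S s A \<in> q"
        using q(2) shift_subset by blast
      then show "s \<in> lead S q A"
        using s sub by (auto simp: lead_def)
    qed
    then show ?thesis
      using lead_subset by blast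
  qed
  ultimately show ?thesis
    by (simp add: semigroup_filter_def)
qed

text \<open>All terms being positive, a finite sum over indices beyond N is at most the
  corresponding tail of the series.\<close>

lemma finite_sums_small:
  assumes pos: "\<And>n. n \<ge> 1 \<Longrightarrow> x n > 0" and summable: "summable (\<lambda>n. x (Suc n))"
    and "\<epsilon> > 0"
  obtains k where "finite_sums x k \<subseteq> {0<..<\<epsilon>}"
proof -
  obtain N where N: "norm (\<Sum>i. x (Suc (i + N))) < \<epsilon>"
    using suminf_exist_split[OF \<open>\<epsilon> > 0\<close> summable] by auto
  have summable': "summable (\<lambda>i. x (Suc (i + N)))"
    using summable_ignore_initial_segment[OF summable, of N] .
  have "sum x F \<in> {0<..<\<epsilon>}" if F: "F \<in> Pf" "F \<subseteq> {Suc N..}" for F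
  proof -
    have inj: "inj_on (\<lambda>n. n - Suc N) F"
      using F(2) by (intro inj_on_diff_nat) auto
    \<comment> \<open>The tail series starts at index N + 1, so index n corresponds to i = n -
      \<open>Suc N\<close>.\<close>
    have "sum x F = (\<Sum>i\<in>(\<lambda>n. n - Suc N) ` F. x (Suc (i + N)))"
      unfolding sum.reindex[OF inj] by (rule sum.cong) (use F(2) in auto)
    also have "\<dots> \<le> (\<Sum>i. x (Suc (i + N)))"
      using F(1) pos by (intro sum_le_suminf[OF summable']) (auto simp: Pf_def less_imp_le)
    also have "\<dots> < \<epsilon>"
      using N by auto
    finally have "sum x F < \<epsilon>" .
    moreover have "sum x F > 0"
      using F(1) pos by (intro sum_pos) (auto simp: Pf_def)
    ultimately show ?thesis by simp
  qed
  then have "finite_sums x (Suc N) \<subseteq> {0<..<\<epsilon>}"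
    by (auto simp: finite_sums_def)
  then show thesis by (rule that)
qed

text \<open>The idempotent is taken above the filter of tails. Convergence makes each interval (0,
  \<open>\<epsilon>\<close>) contain a tail, which places the idempotent in
  \<open>zero_star S\<close>.\<close>

lemma idempotent_of_finite_sums:
  assumes S: "\<And>a b. a \<in> S \<Longrightarrow> b \<in> S \<Longrightarrow> a + b \<in> S" "S \<subseteq> {0<..}"
    and x: "\<And>n. n \<ge> 1 \<Longrightarrow> x n \<in> S" "summable (\<lambda>n. x (Suc n))"
  obtains p where "p \<in> zero_star S" "beta_plus S p p = p"
    "\<And>A k. A \<subseteq> S \<Longrightarrow> finite_sums x k \<subseteq> A \<Longrightarrow> A \<in> p"
proof -
  interpret real_subsemigroup S
    using S(1) by unfold_locales
  obtain p where p: "p \<in> beta S" "{A. A \<subseteq> S \<and> (\<exists>k. finite_sums x k \<subseteq> A)} \<subseteq> p" "beta_plus S p p = p"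
    using idempotent_exists[OF finite_sums_semigroup_filter[OF x(1)]] .
  then have large: "A \<in> p" if "A \<subseteq> S" "finite_sums x k \<subseteq> A" for A k
    using that by blast
  have "{0<..<\<epsilon>} \<inter> S \<in> p" if \<epsilon>: "\<epsilon> > 0" for \<epsilon>
  proof -
    have pos: "x n > 0" if "n \<ge> 1" for n
      using x(1)[OF that] S(2) by auto
    obtain k where "finite_sums x k \<subseteq> {0<..<\<epsilon>}"
      using finite_sums_small[OF pos x(2) \<epsilon>] .
    then have "finite_sums x k \<subseteq> {0<..<\<epsilon>} \<inter> S"
      using finite_sums_subset[of x k, OF x(1)] by simp
    then show ?thesis
      by (rule large[rotated]) simp
  qed
  then have "p \<in> zero_star S"
    using p(1) by (simp add: zero_star_def)
  then show thesis
    using p(3) large by (rule that)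
qed

section \<open>Chains of finite sets and tuples of sums\<close>

text \<open>The condition on the index sets for an arbitrary number of coordinates, so that
  induction is possible. \<open>F\<close> is total, but only its values on \<open>{1..l}\<close>
  count.\<close>

definition chain_upto :: "nat \<Rightarrow> (nat \<Rightarrow> nat set) \<Rightarrow> bool" where
  "chain_upto l F \<longleftrightarrow> (\<forall>i\<in>{1..l}. F i \<in> Pf) \<and> (\<forall>i\<in>{1..<l}. set_less (F i) (F (Suc i)))"

definition sum_tuple :: "(nat \<Rightarrow> nat \<Rightarrow> real) \<Rightarrow> (nat \<Rightarrow> nat set) \<Rightarrow> nat \<Rightarrow> nat \<Rightarrow> real" where
  "sum_tuple x F l = (\<lambda>i\<in>{1..l}. \<Sum>n\<in>F i. x i n)"

lemma sum_tuple_0: "sum_tuple x F 0 = (\<lambda>_. undefined)"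
  by (auto simp: sum_tuple_def)

lemma sum_tuple_Suc: "sum_tuple x F (Suc l) = (sum_tuple x F l)(Suc l := sum (x (Suc l)) (F (Suc l)))"
  by (auto simp: sum_tuple_def fun_eq_iff)

lemma sum_tuple_cong:
  assumes "\<And>i n. i \<in> {1..l} \<Longrightarrow> n \<in> F i \<Longrightarrow> x i n = y i n" "\<And>i. i \<in> {1..l} \<Longrightarrow> F i = G i"
  shows "sum_tuple x F l = sum_tuple y G l"
  unfolding sum_tuple_def by (intro restrict_ext sum.cong) (use assms in auto)

lemma chain_upto_cong:
  assumes "\<And>i. i \<in> {1..l} \<Longrightarrow> F i = G i"
  shows "chain_upto l F \<longleftrightarrow> chain_upto l G"
  using assms by (auto simp: chain_upto_def)

lemma chain_upto_0: "chain_upto 0 F"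
  by (simp add: chain_upto_def)

lemma chain_upto_Suc:
  "chain_upto (Suc l) F \<longleftrightarrow>
     chain_upto l F \<and> F (Suc l) \<in> Pf \<and> (l \<ge> 1 \<longrightarrow> set_less (F l) (F (Suc l)))"
proof -
  have "{1..Suc l} = insert (Suc l) {1..l}" "{1..<Suc l} = (if l \<ge> 1 then insert l {1..<l} else {})"
    by auto
  then show ?thesis
    by (auto simp: chain_upto_def)
qed

text \<open>Only neighbours are compared in \<open>chain_upto\<close>; nonemptiness of the sets in
  between makes the order transitive, with \<open>Max (F l)\<close> as the intermediate
  element.\<close>

lemma chain_upto_less:
  assumes "chain_upto l F" "i \<in> {1..l}" "j \<in> {1..l}" "i < j" "a \<in> F i" "b \<in> F j"
  shows "a < b"
  using assms
proof (induction l arbitrary: j b)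
  case 0
  then show ?case by simp
next
  case (Suc l)
  have Pf: "F k \<in> Pf" if "k \<in> {1..Suc l}" for k
    using Suc.prems(1) that by (auto simp: chain_upto_def)
  show ?case
  proof (cases "j = Suc l")
    case True
    then have l: "l \<ge> 1" "i \<le> l"
      using Suc.prems by auto
    have fin: "finite (F l)" "F l \<noteq> {}" "finite (F j)"
      using Pf[of l] Pf[of j] l Suc.prems by (auto simp: Pf_def)
    have "a \<le> Max (F l)"
    proof (cases "i = l")
      case True
      then show ?thesis using fin Suc.prems by auto
    next
      case False
      have "a < Max (F l)"
        by (rule Suc.IH[of l]) (use False l fin Suc.prems in \<open>auto simp: chain_upto_Suc\<close>)
      then show ?thesis by simp
    qed
    also have "\<dots> < Min (F j)"
      using Suc.prems l True by (simp add: chain_upto_Suc set_less_def)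
    also have "\<dots> \<le> b"
      using fin Suc.prems by simp
    finally show ?thesis .
  next
    case False
    show ?thesis
      by (rule Suc.IH[of j]) (use False Suc.prems in \<open>auto simp: chain_upto_Suc\<close>)
  qed
qed

text \<open>Induction on the number of coordinates. The fibre of \<open>A\<close> over the tuple of
  sums of a chain \<open>F\<close> contains all sums over index sets beyond
  \<open>Max (F (Suc l))\<close>, so it is large; the induction hypothesis then applies to the set
  of tuples with large fibre.\<close>

lemma sum_tuple_in_tensor:
  assumes large: "\<And>i A k. i \<in> {1..Suc l} \<Longrightarrow> A \<subseteq> S i \<Longrightarrow> finite_sums (x i) k \<subseteq> A \<Longrightarrow> A \<in> p i"
    and xS: "\<And>i F. i \<in> {1..Suc l} \<Longrightarrow> F \<in> Pf \<Longrightarrow> sum (x i) F \<in> S i"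
    and A: "A \<subseteq> (\<Pi>\<^sub>E i\<in>{1..Suc l}. S i)" "\<And>F. chain_upto (Suc l) F \<Longrightarrow> sum_tuple x F (Suc l) \<in> A"
  shows "A \<in> tensor S p (Suc l)"
  using assms
proof (induction l arbitrary: A)
  case 0
  \<comment> \<open>The bound 0 excludes no set of \<open>Pf\<close>, as there is no earlier
    coordinate to stay beyond.\<close>
  have "finite_sums (x 1) 0 \<subseteq> {y \<in> S 1. (\<lambda>i\<in>{1..1}. y) \<in> A}"
  proof
    fix y assume "y \<in> finite_sums (x 1) 0"
    then obtain F where F: "F \<in> Pf" "y = sum (x 1) F"
      by (auto simp: finite_sums_def)
    have "sum_tuple x (\<lambda>_. F) (Suc 0) \<in> A"
      using F by (intro 0) (simp add: chain_upto_Suc chain_upto_0)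
    moreover have "sum_tuple x (\<lambda>_. F) (Suc 0) = (\<lambda>i\<in>{1..1}. y)"
      by (auto simp: sum_tuple_def F(2))
    ultimately show "y \<in> {y \<in> S 1. (\<lambda>i\<in>{1..1}. y) \<in> A}"
      using F 0(2)[of 1 F] by simp
  qed
  then have "{y \<in> S 1. (\<lambda>i\<in>{1..1}. y) \<in> A} \<in> p 1"
    by (intro 0(1)) auto
  then show ?case
    using 0(3) by simp
next
  case (Suc l)
  let ?B = "{t \<in> (\<Pi>\<^sub>E i\<in>{1..Suc l}. S i). {y \<in> S (Suc l + 1). t(Suc l + 1 := y) \<in> A} \<in> p (Suc l + 1)}"
  have "?B \<in> tensor S p (Suc l)"
  proof (rule Suc.IH)
    show "sum_tuple x F (Suc l) \<in> ?B" if F: "chain_upto (Suc l) F" for F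
    proof -
      have "finite_sums (x (Suc l + 1)) (Suc (Max (F (Suc l))))
          \<subseteq> {y \<in> S (Suc l + 1). (sum_tuple x F (Suc l))(Suc l + 1 := y) \<in> A}"
      proof
        fix y assume "y \<in> finite_sums (x (Suc l + 1)) (Suc (Max (F (Suc l))))"
        then obtain G where G: "G \<in> Pf" "G \<subseteq> {Suc (Max (F (Suc l)))..}" "y = sum (x (Suc l + 1)) G"
          by (auto simp: finite_sums_def)
        have "set_less (F (Suc l)) G"
          using G Min_in[of G] by (force simp: set_less_def Pf_def)
        let ?F = "F(Suc (Suc l) := G)"
        have "chain_upto (Suc l) ?F"
          using F chain_upto_cong[of "Suc l" F ?F] by auto
        then have "chain_upto (Suc (Suc l)) ?F"
          using G \<open>set_less (F (Suc l)) G\<close> by (subst chain_upto_Suc) auto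
        then have "sum_tuple x ?F (Suc (Suc l)) \<in> A"
          by (rule Suc.prems)
        moreover have "sum_tuple x ?F (Suc l) = sum_tuple x F (Suc l)"
          by (rule sum_tuple_cong) auto
        ultimately have "(sum_tuple x F (Suc l))(Suc l + 1 := y) \<in> A"
          by (subst (asm) sum_tuple_Suc) (simp add: G(3))
        then show "y \<in> {y \<in> S (Suc l + 1). (sum_tuple x F (Suc l))(Suc l + 1 := y) \<in> A}"
          using G Suc.prems(2) by auto
      qed
      then have "{y \<in> S (Suc l + 1). (sum_tuple x F (Suc l))(Suc l + 1 := y) \<in> A} \<in> p (Suc l + 1)"
        by (intro Suc.prems(1)) auto
      moreover have "sum_tuple x F (Suc l) \<in> (\<Pi>\<^sub>E i\<in>{1..Suc l}. S i)"
        unfolding sum_tuple_def using F Suc.prems(2) by (auto simp: chain_upto_def)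
      ultimately show ?thesis by blast
    qed
  qed (use Suc.prems in auto)
  then show ?case
    using Suc.prems(3) by (simp add: Let_def)
qed

section \<open>Sequences from idempotents\<close>

text \<open>Reading the definition from \<open>A\<close> downwards, \<open>D k\<close> consists of
  the k-tuples with a large set of continuations into \<open>D (Suc k)\<close>. Starting at the
  empty tuple \<open>\<lambda>_. undefined\<close> lets the first coordinate be treated like all
  others.\<close>

lemma tensor_unfold:
  assumes "A \<in> tensor S p (Suc l)"
  obtains D where "D (Suc l) = A" "(\<lambda>_. undefined) \<in> D 0"
    "\<forall>k<Suc l. \<forall>t\<in>D k. {y \<in> S (Suc k). t(Suc k := y) \<in> D (Suc k)} \<in> p (Suc k)"
proof -
  have "\<exists>D. D (Suc l) = A \<and> (\<lambda>_. undefined) \<in> D 0 \<and>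
    (\<forall>k<Suc l. \<forall>t\<in>D k. {y \<in> S (Suc k). t(Suc k := y) \<in> D (Suc k)} \<in> p (Suc k))"
    using assms
  proof (induction l arbitrary: A)
    case 0
    have "(\<lambda>_. undefined)(Suc 0 := y) = (\<lambda>i\<in>{1..1}. y)" for y :: 'a
      by auto
    then have "{y \<in> S (Suc 0). (\<lambda>_. undefined)(Suc 0 := y) \<in> A} \<in> p (Suc 0)"
      using 0 by (simp only: tensor.simps mem_Collect_eq One_nat_def)
    then show ?case
      by (intro exI[of _ "\<lambda>k. if k = 0 then {\<lambda>_. undefined} else A"]) (simp del: fun_upd_apply)
  next
    case (Suc l)
    let ?B = "{t \<in> (\<Pi>\<^sub>E i\<in>{1..Suc l}. S i). {y \<in> S (Suc (Suc l)). t(Suc (Suc l) := y) \<in> A} \<in> p (Suc (Suc l))}"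
    have B: "?B \<in> tensor S p (Suc l)"
      using Suc.prems by (simp add: Let_def)
    obtain D where D: "D (Suc l) = ?B" "(\<lambda>_. undefined) \<in> D 0"
      "\<forall>k<Suc l. \<forall>t\<in>D k. {y \<in> S (Suc k). t(Suc k := y) \<in> D (Suc k)} \<in> p (Suc k)"
      using Suc.IH[OF B] by (elim exE conjE)
    show ?case
      by (rule exI[of _ "\<lambda>k. if k = Suc (Suc l) then A else D k"])
        (use D in \<open>auto simp: less_Suc_eq simp del: fun_upd_apply\<close>)
  qed
  then show thesis
    using that by blast
qed

section \<open>Simultaneous recursive construction of the sequences\<close>

locale tensor_idempotents =
  fixes m :: nat and S :: "nat \<Rightarrow> real set" and p :: "nat \<Rightarrow> real set set"
    and D :: "nat \<Rightarrow> (nat \<Rightarrow> real) set"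
  assumes add_closed: "\<And>k a b. k < m \<Longrightarrow> a \<in> S (Suc k) \<Longrightarrow> b \<in> S (Suc k) \<Longrightarrow> a + b \<in> S (Suc k)"
    and zero_star: "\<And>k. k < m \<Longrightarrow> p (Suc k) \<in> zero_star (S (Suc k))"
    and idempotent: "\<And>k. k < m \<Longrightarrow> beta_plus (S (Suc k)) (p (Suc k)) (p (Suc k)) = p (Suc k)"
    and D_0: "(\<lambda>_. undefined) \<in> D 0"
    and D_Suc: "\<And>k t. k < m \<Longrightarrow> t \<in> D k \<Longrightarrow>
      {y \<in> S (Suc k). t(Suc k := y) \<in> D (Suc k)} \<in> p (Suc k)"
begin

definition extensions :: "nat \<Rightarrow> (nat \<Rightarrow> real) \<Rightarrow> real set" where
  "extensions k t = {y \<in> S (Suc k). t(Suc k := y) \<in> D (Suc k)}"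

text \<open>The set B* with respect to the idempotent \<open>p (Suc k)\<close>, for B =
  \<open>extensions k t\<close>.\<close>

definition star :: "nat \<Rightarrow> (nat \<Rightarrow> real) \<Rightarrow> real set" where
  "star k t = extensions k t \<inter> lead (S (Suc k)) (p (Suc k)) (extensions k t)"

lemma p_beta: "k < m \<Longrightarrow> p (Suc k) \<in> beta (S (Suc k))"
  using zero_star by (simp add: zero_star_def)

lemma star_large:
  assumes "k < m" "t \<in> D k"
  shows "star k t \<in> p (Suc k)"
    and "s \<in> star k t \<Longrightarrow> shift (S (Suc k)) s (star k t) \<in> p (Suc k)"
proof -
  interpret real_subsemigroup "S (Suc k)"
    using add_closed assms(1) by unfold_locales
  have "extensions k t \<in> p (Suc k)"
    using D_Suc assms by (simp add: extensions_def)
  then show "star k t \<in> p (Suc k)"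
    "s \<in> star k t \<Longrightarrow> shift (S (Suc k)) s (star k t) \<in> p (Suc k)"
    unfolding star_def
    using idempotent_star[OF p_beta[OF assms(1)] idempotent[OF assms(1)]] by auto
qed

text \<open>
  In an admissible pair \<open>(F, G)\<close> the set \<open>G\<close> is empty or extends the chain \<open>F 1 < \<dots> < F k\<close>;
  the new index \<open>n\<close> is going to be appended to \<open>G\<close>.
\<close>

definition admissible :: "nat \<Rightarrow> nat \<Rightarrow> (nat \<Rightarrow> nat set) \<Rightarrow> nat set \<Rightarrow> bool" where
  "admissible k n F G \<longleftrightarrow> chain_upto k F \<and> (\<forall>i\<in>{1..k}. F i \<subseteq> {..<n}) \<and> G \<subseteq> {..<n}
     \<and> (G \<noteq> {} \<longrightarrow> chain_upto (Suc k) (F(Suc k := G)))"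

text \<open>
  The first argument of \<open>good_terms\<close> has the index \<open>n\<close> of the term first and the coordinate second.
\<close>

definition good_terms :: "(nat \<Rightarrow> nat \<Rightarrow> real) \<Rightarrow> nat \<Rightarrow> (nat \<Rightarrow> real) \<Rightarrow> bool" where
  "good_terms c n r \<longleftrightarrow> (\<forall>k<m. r (Suc k) \<in> S (Suc k) \<inter> {0<..<(1/2)^n}
     \<and> (\<forall>F G. admissible k n F G \<longrightarrow>
           (\<Sum>j\<in>G. c j (Suc k)) + r (Suc k) \<in> star k (sum_tuple (\<lambda>i j. c j i) F k)))"

text \<open>Admissible sets lie in \<open>{..<n}\<close>, so only terms of \<open>c\<close> before
  \<open>n\<close> are read; the recursive choice of the terms rests on this.\<close>

lemma good_terms_cong:
  assumes "\<And>j. j < n \<Longrightarrow> c j = d j"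
  shows "good_terms c n r = good_terms d n r"
proof -
  have "(\<Sum>j\<in>G. c j (Suc k)) = (\<Sum>j\<in>G. d j (Suc k))"
    "sum_tuple (\<lambda>i j. c j i) F k = sum_tuple (\<lambda>i j. d j i) F k" if "admissible k n F G" for k F G
  proof -
    show "(\<Sum>j\<in>G. c j (Suc k)) = (\<Sum>j\<in>G. d j (Suc k))"
      using that assms by (intro sum.cong) (auto simp: admissible_def)
    show "sum_tuple (\<lambda>i j. c j i) F k = sum_tuple (\<lambda>i j. d j i) F k"
    proof (rule sum_tuple_cong)
      show "c j i = d j i" if "i \<in> {1..k}" "j \<in> F i" for i j
      proof -
        have "j < n"
          using that \<open>admissible k n F G\<close> unfolding admissible_def by blast
        then show ?thesis
          by (simp add: assms)
      qed
    qed simp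
  qed
  then show ?thesis
    unfolding good_terms_def by auto
qed

text \<open>Let n be the largest index in \<open>F (Suc k)\<close>. All other indices of the chain
  are below n, so \<open>F\<close> with the rest of \<open>F (Suc k)\<close> is an admissible pair
  at stage n, and the condition imposed on term n is the claim.\<close>

lemma good_terms_sums:
  assumes cols: "\<And>j. j \<in> F (Suc k) \<Longrightarrow> good_terms c j (c j)" and k: "k < m" and F: "chain_upto (Suc k) F"
  shows "(\<Sum>j\<in>F (Suc k). c j (Suc k)) \<in> star k (sum_tuple (\<lambda>i j. c j i) F k)"
proof -
  let ?G = "F (Suc k)"
  define n where "n = Max ?G"
  have G: "?G \<in> Pf"
    using F by (simp add: chain_upto_Suc)
  then have n: "n \<in> ?G" "finite ?G" "\<And>j. j \<in> ?G \<Longrightarrow> j \<le> n"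
    unfolding n_def by (auto simp: Pf_def)
  have "a < n" if "i \<in> {1..k}" "a \<in> F i" for i a
    by (rule chain_upto_less[OF F, of i "Suc k"]) (use that n in auto)
  moreover have "?G - {n} \<subseteq> {..<n}"
    using n(3) by (auto simp: less_le)
  moreover have "chain_upto (Suc k) (F(Suc k := ?G - {n}))" if ne: "?G - {n} \<noteq> {}"
  proof -
    have "chain_upto k (F(Suc k := ?G - {n}))"
      using F chain_upto_cong[of k F "F(Suc k := ?G - {n})"] by (auto simp: chain_upto_Suc)
    moreover have "set_less (F k) (?G - {n})" if "k \<ge> 1"
    proof -
      \<comment> \<open>Deleting the maximum cannot lower the minimum, so the shortened set still
        comes after \<open>F k\<close>.\<close>
      have "Min ?G \<le> Min (?G - {n})"
        using ne n(2) by (intro Min_antimono) auto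
      then show ?thesis
        using F that by (simp add: chain_upto_Suc set_less_def)
    qed
    ultimately show ?thesis
      using G ne by (subst chain_upto_Suc) (auto simp: Pf_def)
  qed
  ultimately have "admissible k n F (?G - {n})"
    using F unfolding admissible_def by (auto simp: chain_upto_Suc)
  then have "(\<Sum>j\<in>?G - {n}. c j (Suc k)) + c n (Suc k) \<in> star k (sum_tuple (\<lambda>i j. c j i) F k)"
    using cols[OF n(1)] k by (simp add: good_terms_def)
  then show ?thesis
    using n by (simp add: sum.remove[of ?G n] add.commute)
qed

text \<open>As \<open>star\<close> is contained in \<open>extensions\<close>, membership of the last
  sum in \<open>star\<close> already puts the extended tuple into \<open>D l\<close>.\<close>

lemma good_terms_tuples:
  assumes cols: "\<And>i j. i \<in> {1..l} \<Longrightarrow> j \<in> F i \<Longrightarrow> good_terms c j (c j)" and l: "l \<le> m" and F: "chain_upto l F"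
  shows "sum_tuple (\<lambda>i j. c j i) F l \<in> D l"
proof (cases l)
  case 0
  then show ?thesis by (simp add: sum_tuple_0 D_0)
next
  case (Suc k)
  have "(\<Sum>j\<in>F (Suc k). c j (Suc k)) \<in> star k (sum_tuple (\<lambda>i j. c j i) F k)"
    using cols l F Suc by (intro good_terms_sums) auto
  then show ?thesis
    by (simp add: Suc sum_tuple_Suc star_def extensions_def)
qed

text \<open>The pairs themselves can be infinite in number, as \<open>F\<close> is arbitrary outside
  \<open>{1..k}\<close>; but a tuple of sums depends only on k subsets of
  \<open>{..<n}\<close>.\<close>

lemma finite_admissible:
  "finite ((\<lambda>(F, G). (sum_tuple x F k, G)) ` {(F, G). admissible k n F G})"
proof (rule finite_subset)
  show "(\<lambda>(F, G). (sum_tuple x F k, G)) ` {(F, G). admissible k n F G}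
      \<subseteq> (\<lambda>F. sum_tuple x F k) ` (\<Pi>\<^sub>E i\<in>{1..k}. Pow {..<n}) \<times> Pow {..<n}"
  proof
    fix z assume "z \<in> (\<lambda>(F, G). (sum_tuple x F k, G)) ` {(F, G). admissible k n F G}"
    then obtain F G where FG: "admissible k n F G" and z: "z = (sum_tuple x F k, G)"
      by auto
    have "sum_tuple x F k = sum_tuple x (restrict F {1..k}) k"
      by (rule sum_tuple_cong) auto
    moreover have "restrict F {1..k} \<in> (\<Pi>\<^sub>E i\<in>{1..k}. Pow {..<n})"
      using FG by (auto simp: admissible_def)
    ultimately have "sum_tuple x F k \<in> (\<lambda>F. sum_tuple x F k) ` (\<Pi>\<^sub>E i\<in>{1..k}. Pow {..<n})"
      by (rule image_eqI)
    then show "z \<in> (\<lambda>F. sum_tuple x F k) ` (\<Pi>\<^sub>E i\<in>{1..k}. Pow {..<n}) \<times> Pow {..<n}"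
      using FG by (simp add: z admissible_def)
  qed
qed (simp add: finite_PiE)

text \<open>Each admissible pair asks the new term to lie in a large set: \<open>star\<close> itself
  if \<open>G\<close> is empty, otherwise its translate by the sum over \<open>G\<close>, which is
  in \<open>star\<close> by the earlier choices. Finitely many such sets occur, and their
  intersection meets (0, (1/2)^n), which is large since \<open>p (Suc k)\<close> is in
  \<open>zero_star\<close>.\<close>

lemma good_terms_exists:
  assumes cols: "\<And>j. j < n \<Longrightarrow> good_terms c j (c j)"
  shows "\<exists>r. good_terms c n r"
proof -
  let ?x = "\<lambda>i j. c j i"
  have "\<exists>y. y \<in> S (Suc k) \<inter> {0<..<(1/2)^n}
     \<and> (\<forall>F G. admissible k n F G \<longrightarrow> (\<Sum>j\<in>G. c j (Suc k)) + y \<in> star k (sum_tuple ?x F k))"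
    if k: "k < m" for k
  proof -
    let ?S = "S (Suc k)" and ?p = "p (Suc k)"
    let ?I = "(\<lambda>(F, G). (sum_tuple ?x F k, G)) ` {(F, G). admissible k n F G}"
    have pf: "proper_filter ?S ?p"
      using p_beta[OF k] by (rule beta_proper_filter)
    have "{y \<in> ?S. (\<Sum>j\<in>G. c j (Suc k)) + y \<in> star k (sum_tuple ?x F k)} \<in> ?p"
      if FG: "admissible k n F G" for F G
    proof -
      have t: "sum_tuple ?x F k \<in> D k"
        using FG k by (intro good_terms_tuples cols) (auto simp: admissible_def)
      show ?thesis
      proof (cases "G = {}")
        case True
        have "{y \<in> ?S. y \<in> star k (sum_tuple ?x F k)} = star k (sum_tuple ?x F k)"
          by (auto simp: star_def extensions_def)
        then show ?thesis
          using True star_large(1)[OF k t] by simp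
      next
        case False
        have G: "chain_upto (Suc k) (F(Suc k := G))" "\<forall>j\<in>G. j < n"
          using FG False unfolding admissible_def by blast+
        have "(\<Sum>j\<in>(F(Suc k := G)) (Suc k). c j (Suc k)) \<in> star k (sum_tuple ?x (F(Suc k := G)) k)"
          by (rule good_terms_sums[OF _ k G(1)]) (use G(2) cols in simp)
        moreover have "sum_tuple ?x (F(Suc k := G)) k = sum_tuple ?x F k"
          by (rule sum_tuple_cong) auto
        ultimately show ?thesis
          using star_large(2)[OF k t] by (simp add: shift_def)
      qed
    qed
    then have "{y \<in> ?S. \<forall>i\<in>?I. y \<in> (\<lambda>(t, G). {y \<in> ?S. (\<Sum>j\<in>G. c j (Suc k)) + y \<in> star k t}) i} \<in> ?p"
      by (intro proper_filter_Inter[OF pf finite_admissible]) auto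
    moreover have "{0<..<(1/2)^n} \<inter> ?S \<in> ?p"
      using zero_star[OF k] by (simp add: zero_star_def)
    ultimately have "{y \<in> ?S. \<forall>i\<in>?I. y \<in> (\<lambda>(t, G). {y \<in> ?S. (\<Sum>j\<in>G. c j (Suc k)) + y \<in> star k t}) i}
        \<inter> ({0<..<(1/2)^n} \<inter> ?S) \<noteq> {}"
      using proper_filter_nonempty[OF pf] proper_filter_Int[OF pf] by blast
    then show ?thesis by fastforce
  qed
  then obtain r where "\<forall>k<m. r k \<in> S (Suc k) \<inter> {0<..<(1/2)^n}
     \<and> (\<forall>F G. admissible k n F G \<longrightarrow> (\<Sum>j\<in>G. c j (Suc k)) + r k \<in> star k (sum_tuple ?x F k))"
    by metis
  \<comment> \<open>The choice \<open>r k\<close> was made for coordinate \<open>Suc k\<close>,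
    hence the shift.\<close>
  then have "good_terms c n (\<lambda>i. r (i - 1))"
    by (simp add: good_terms_def)
  then show ?thesis by blast
qed

lemma good_sequence_exists: "\<exists>c. \<forall>n. good_terms c n (c n)"
proof (rule dependent_wellorder_choice)
  show "good_terms c n r = good_terms d n r" if "\<And>j. j < n \<Longrightarrow> c j = d j" for r c d n
    using that by (rule good_terms_cong)
  show "\<exists>r. good_terms c n r" if "\<And>j. j < n \<Longrightarrow> good_terms c j (c j)" for n c
    using that by (rule good_terms_exists)
qed

text \<open>Terms of index n lie below (1/2)^n, so the series converge by comparison with a
  geometric series. Terms of index 0 are constructed as well, while chains and series start at index
  1.\<close>

theorem sequences_exist:
  obtains x where "\<forall>i\<in>{1..m}. (\<forall>n. x i n \<in> S i) \<and> summable (\<lambda>n. x i (Suc n))"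
    "\<forall>F. chain_upto m F \<longrightarrow> sum_tuple x F m \<in> D m"
proof -
  obtain c where c: "\<And>n. good_terms c n (c n)"
    using good_sequence_exists by blast
  have x: "c n i \<in> S i" "0 < c n i" "c n i < (1/2)^n" if "i \<in> {1..m}" for i n
    using c[of n, unfolded good_terms_def, THEN spec, of "i - 1"] that by auto
  have "summable (\<lambda>n. c (Suc n) i)" if "i \<in> {1..m}" for i
  proof (rule summable_comparison_test)
    show "\<exists>N. \<forall>n\<ge>N. norm (c (Suc n) i) \<le> (1/2)^Suc n"
      using x(2,3)[OF that] by (intro exI[of _ 0]) (simp add: less_imp_le del: power_Suc)
    show "summable (\<lambda>n. (1/2)^Suc n :: real)"
      by (intro summable_Suc_iff[THEN iffD2] summable_geometric) simp
  qed
  moreover have "sum_tuple (\<lambda>i n. c n i) F m \<in> D m" if "chain_upto m F" for F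
    using c that by (intro good_terms_tuples) auto
  ultimately show thesis
    using x(1) by (intro that[of "\<lambda>i n. c n i"]) auto
qed

end

section \<open>Equivalence of idempotents and sequences\<close>

theorem theorem4p12:
  fixes m :: nat and S :: "nat \<Rightarrow> real set" and A :: "(nat \<Rightarrow> real) set"
  assumes "m \<ge> 1"
    and "\<And>i. i \<in> {1..m} \<Longrightarrow> S i \<subseteq> {0<..}"
    and "\<And>i. i \<in> {1..m} \<Longrightarrow> dense_subsemigroup (S i)"
    and "A \<subseteq> (\<Pi>\<^sub>E i\<in>{1..m}. S i)"
  shows "(\<exists>p. (\<forall>i\<in>{1..m}. p i \<in> zero_star (S i) \<and> beta_plus (S i) (p i) (p i) = p i)
            \<and> A \<in> tensor S p m)
     \<longleftrightarrow>
         (\<exists>x :: nat \<Rightarrow> nat \<Rightarrow> real.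
            (\<forall>i\<in>{1..m}. (\<forall>n\<ge>1. x i n \<in> S i) \<and> summable (\<lambda>n. x i (Suc n)))
            \<and> {(\<lambda>i\<in>{1..m}. \<Sum>n\<in>F i. x i n) | F.
                 (\<forall>i\<in>{1..m}. F i \<in> Pf) \<and> (\<forall>i\<in>{1..<m}. set_less (F i) (F (Suc i)))} \<subseteq> A)"
    (is "?L \<longleftrightarrow> ?R")
proof
  have closed: "a + b \<in> S i" if "i \<in> {1..m}" "a \<in> S i" "b \<in> S i" for i a b
    using assms(3)[OF that(1)] that(2,3) by (simp add: dense_subsemigroup_def)
  \<comment> \<open>The lemmas on \<open>tensor\<close> are stated for successors because its value
    at 0 is a dummy.\<close>
  obtain l where l: "m = Suc l"
    using assms(1) by (cases m) auto
  show ?R if ?L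
  proof -
    from that obtain p where p: "\<forall>i\<in>{1..m}. p i \<in> zero_star (S i) \<and> beta_plus (S i) (p i) (p i) = p i"
      "A \<in> tensor S p (Suc l)"
      unfolding l by blast
    obtain D where D: "D (Suc l) = A" "(\<lambda>_. undefined) \<in> D 0"
      "\<forall>k<Suc l. \<forall>t\<in>D k. {y \<in> S (Suc k). t(Suc k := y) \<in> D (Suc k)} \<in> p (Suc k)"
      by (rule tensor_unfold[OF p(2)])
    interpret tensor_idempotents m S p D
      using closed p(1) D l by unfold_locales auto
    obtain x where "\<forall>i\<in>{1..m}. (\<forall>n. x i n \<in> S i) \<and> summable (\<lambda>n. x i (Suc n))"
      "\<forall>F. chain_upto m F \<longrightarrow> sum_tuple x F m \<in> D m"
      by (rule sequences_exist)
    then show ?thesis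
      using D(1) l by (intro exI[of _ x]) (auto simp: chain_upto_def sum_tuple_def)
  qed
  show ?L if ?R
  proof -
    from that obtain x where xS: "\<forall>i\<in>{1..m}. (\<forall>n\<ge>1. x i n \<in> S i) \<and> summable (\<lambda>n. x i (Suc n))"
      and xA: "{sum_tuple x F m | F. chain_upto m F} \<subseteq> A"
      unfolding chain_upto_def sum_tuple_def by (elim exE conjE)
    have x: "\<And>i n. i \<in> {1..m} \<Longrightarrow> n \<ge> 1 \<Longrightarrow> x i n \<in> S i"
      "\<And>i. i \<in> {1..m} \<Longrightarrow> summable (\<lambda>n. x i (Suc n))"
      "\<And>F. chain_upto m F \<Longrightarrow> sum_tuple x F m \<in> A"
      using xS xA by auto
    \<comment> \<open>The idempotents are found one coordinate at a time; the last property, that p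
      contains every set including a tail, is what \<open>sum_tuple_in_tensor\<close> asks of
      them.\<close>
    have "\<exists>p. p \<in> zero_star (S i) \<and> beta_plus (S i) p p = p
        \<and> (\<forall>B k. B \<subseteq> S i \<longrightarrow> finite_sums (x i) k \<subseteq> B \<longrightarrow> B \<in> p)" if "i \<in> {1..m}" for i
      by (rule idempotent_of_finite_sums[of "S i" "x i"])
        (use closed that assms(2) x(1,2) in auto)
    then obtain p where p: "\<And>i. i \<in> {1..m} \<Longrightarrow> p i \<in> zero_star (S i)"
      "\<And>i. i \<in> {1..m} \<Longrightarrow> beta_plus (S i) (p i) (p i) = p i"
      "\<And>i B k. i \<in> {1..m} \<Longrightarrow> B \<subseteq> S i \<Longrightarrow> finite_sums (x i) k \<subseteq> B \<Longrightarrow> B \<in> p i"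
      by metis
    have "A \<in> tensor S p (Suc l)"
    proof (rule sum_tuple_in_tensor)
      show "sum (x i) F \<in> S i" if i: "i \<in> {1..Suc l}" and "F \<in> Pf" for i F
      proof -
        interpret real_subsemigroup "S i"
          using closed i l by unfold_locales auto
        show ?thesis
          using that x(1) l by (intro sum_closed) (auto simp: Pf_def)
      qed
    qed (use p x(3) assms(4) l in \<open>auto simp: zero_star_def\<close>)
    then show ?thesis
      using p l by blast
  qed
qed

end
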